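(* Let $q$ be a complex number with $|q|<1$ and let $k$ be a positive integer. Then \begin{align*} \frac{1}{(q;q)_{\infty}}\sum_{n=k}^{\infty}(-1)^{n-k}\frac{2n+1}{2k+1}{n+k\choose 2k}q^{\frac{n(n+1)}{2}} &=\sum_{i=0}^{\infty}\sum_{j=i+k}^{\infty}(-1)^{j-i-k}\frac{j-i}{k}{j-i+k-1\choose 2k-1} \frac{q^{\frac{i(i+1)}{2}+\frac{j(j+1)}{2}}}{(q;q)_i(q;q)_j},\\ \frac{1}{(q^2;q^2)_{\infty}}\sum_{n=k}^{\infty}(-1)^{n-k}\frac{2n}{n+k}{n+k\choose 2k}q^{n^2} &=\sum_{i=0}^{\infty}\sum_{j=i+k}^{\infty}(-1)^{j-i-k}\frac{j-i}{k}{j-i+k-1\choose 2k-1}\frac{ q^{i^2+j^2}}{(q^2;q^2)_i(q^2;q^2)_j}. \end{align*}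
   Context: The $q$-shifted factorial is $(a;q)_0=1$, $(a;q)_n=(1-a)(1-aq)\cdots(1-aq^{n-1})$ for $n\ge1$, and $(a;q)_\infty=\prod_{r=0}^{\infty}(1-aq^r)$. ${a\choose b}$ denotes the ordinary binomial coefficient. *)

theory Defs
  imports "HOL-Analysis.Analysis"
begin

definition qpoch :: "complex \<Rightarrow> complex \<Rightarrow> nat \<Rightarrow> complex" where
  "qpoch a q n = (\<Prod>r<n. 1 - a * q ^ r)"

definition qpoch_inf :: "complex \<Rightarrow> complex \<Rightarrow> complex" where
  "qpoch_inf a q = (\<Prod>r. 1 - a * q ^ r)"

(* The infinite product genuinely converges for norm q < 1, so qpoch_inf is not a junk value there. *)
lemma convergent_prod_qpoch_inf:
  fixes a q :: complex
  assumes "norm q < 1"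
  shows "convergent_prod (\<lambda>r. 1 - a * q ^ r)"
proof -
  have "summable (\<lambda>r. norm ((1 - a * q ^ r) - 1))"
    using assms by (auto simp: norm_mult norm_power intro!: summable_mult summable_geometric)
  then show ?thesis
    by (intro abs_convergent_prod_imp_convergent_prod summable_imp_abs_convergent_prod)
qed

end

theory Submission
  imports Defs
begin

text \<open>
  Grouping the double sum by \<open>m = j - i\<close> reduces it to the sums
  \<open>G(m,s) = \<Sum>i. q^(i^2 + i s) / ((q;q)\<^sub>i (q;q)\<^sub>i\<^sub>+\<^sub>m)\<close>. Two contiguous relations show that
  \<open>D(m) = G(m,m) - G(m+1,m+1)\<close> satisfies \<open>D(m) = - q^(m+1) D(m+1)\<close>; as \<open>D\<close> is bounded, it
  vanishes, and letting \<open>m\<close> tend to infinity gives Cauchy's identity \<open>G(m,m) = 1 / (q;q)\<^sub>\<infinity>\<close>.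
  With \<open>q^2\<close> in place of \<open>q\<close> this is the second identity. In the first one the \<open>m\<close>-th group is
  \<open>c(m) = q^(m(m+1)/2) G(m,m+1)\<close>, and \<open>c(m) + c(m+1) = q^(m(m+1)/2) / (q;q)\<^sub>\<infinity>\<close>. The weights
  on the left are the partial sums of those on the right, so summation by parts finishes the proof.
\<close>

section \<open>The q-shifted factorials (q;q)_n: nonvanishing, limit and bounds\<close>

lemma qpoch_0 [simp]: "qpoch a q 0 = 1"
  by (simp add: qpoch_def)

lemma qpoch_Suc: "qpoch a q (Suc n) = qpoch a q n * (1 - a * q ^ n)"
  by (simp add: qpoch_def)

lemma power_neq_1:
  fixes q :: "'a::real_normed_div_algebra"
  assumes "norm q < 1" "n > 0"
  shows "q ^ n \<noteq> 1"
proof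
  assume "q ^ n = 1"
  then have "norm q ^ n = 1" by (metis norm_power norm_one)
  then show False
    using assms power_less_one_iff[of "norm q" n] by simp
qed

lemma qpoch_nonzero:
  assumes "norm q < 1"
  shows "qpoch q q n \<noteq> 0"
  using power_neq_1[OF assms, of "Suc _"] by (auto simp: qpoch_def)

lemma qpoch_inf_nonzero:
  assumes "norm q < 1"
  shows "qpoch_inf q q \<noteq> 0"
  unfolding qpoch_inf_def
  by (intro prodinf_nonzero convergent_prod_qpoch_inf assms)
     (use power_neq_1[OF assms, of "Suc _"] in auto)

lemma inverse_qpoch_tendsto:
  assumes "norm q < 1"
  shows "(\<lambda>n. 1 / qpoch q q n) \<longlonglongrightarrow> 1 / qpoch_inf q q"
proof (intro tendsto_divide tendsto_const qpoch_inf_nonzero assms)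
  show "qpoch q q \<longlonglongrightarrow> qpoch_inf q q"
    unfolding qpoch_def qpoch_inf_def LIMSEQ_lessThan_iff_atMost
    by (intro convergent_prod_LIMSEQ convergent_prod_qpoch_inf assms)
qed

lemma inverse_qpoch_bounded:
  assumes "norm q < 1"
  obtains C where "C > 0" "\<And>n. norm (1 / qpoch q q n) \<le> C"
  using convergent_imp_Bseq[OF convergentI[OF inverse_qpoch_tendsto[OF assms]]]
  unfolding Bseq_def by blast

lemma norm_power_le_power:
  fixes q :: "'a::real_normed_div_algebra"
  assumes "norm q < 1" "i \<le> e"
  shows "norm (q ^ e) \<le> norm q ^ i"
  using assms by (simp add: norm_power power_decreasing)

section \<open>Durfee-type series: uniform bounds and contiguous relations\<close>

text \<open>For s = m this is the generating function of the partitions with Durfee rectangle of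
  size i by (i + m), whence the name. The parameter s is kept separate because the contiguous
  relations shift it independently of m, and the first identity needs s = m + 1.\<close>

definition durfee_term :: "complex \<Rightarrow> nat \<Rightarrow> nat \<Rightarrow> nat \<Rightarrow> complex" where
  "durfee_term q m s i = q ^ (i ^ 2 + i * s) / (qpoch q q i * qpoch q q (i + m))"

definition durfee_sum :: "complex \<Rightarrow> nat \<Rightarrow> nat \<Rightarrow> complex" where
  "durfee_sum q m s = (\<Sum>i. durfee_term q m s i)"

text \<open>The constant is the square of a bound for the 1 / (q;q)_n, hence independent of m, s and
  i. The exponent e is left open: e = i gives summability, e = s + i the decay of the tail in
  s.\<close>

lemma durfee_term_bounded:
  assumes "norm q < 1"
  shows "\<exists>C>0. \<forall>m s i e. e \<le> i ^ 2 + i * s \<longrightarrow> norm (durfee_term q m s i) \<le> C * norm q ^ e"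
proof -
  obtain C where C: "C > 0" "\<And>n. norm (1 / qpoch q q n) \<le> C"
    using inverse_qpoch_bounded[OF assms] by blast
  have "norm (durfee_term q m s i) \<le> C * C * norm q ^ e" if "e \<le> i ^ 2 + i * s" for m s i e
  proof -
    have "norm (durfee_term q m s i)
        = norm (1 / qpoch q q i) * norm (1 / qpoch q q (i + m)) * norm (q ^ (i ^ 2 + i * s))"
      by (simp add: durfee_term_def norm_mult norm_divide)
    also have "\<dots> \<le> C * C * norm q ^ e"
      using C norm_power_le_power[OF assms that] by (intro mult_mono) auto
    finally show ?thesis .
  qed
  with C show ?thesis
    by (intro exI[of _ "C * C"]) simp
qed

lemma durfee_term_le_geometric:
  assumes "norm q < 1"
  obtains C where "\<And>m s i. norm (durfee_term q m s i) \<le> C * norm q ^ i"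
proof -
  obtain C where "\<forall>m s i e. e \<le> i ^ 2 + i * s \<longrightarrow> norm (durfee_term q m s i) \<le> C * norm q ^ e"
    using durfee_term_bounded[OF assms] by blast
  then show ?thesis
    by (intro that[of C]) (simp add: power2_eq_square trans_le_add1)
qed

lemma summable_norm_durfee_term:
  assumes "norm q < 1"
  shows "summable (\<lambda>i. norm (durfee_term q m s i))"
proof -
  obtain C where C: "\<And>m s i. norm (durfee_term q m s i) \<le> C * norm q ^ i"
    using durfee_term_le_geometric[OF assms] by blast
  show ?thesis
  proof (rule summable_comparison_test'[where N = 0])
    show "summable (\<lambda>i. C * norm q ^ i)"
      using assms by (intro summable_mult summable_geometric) auto
  qed (use C in auto)
qed

lemma durfee_term_sums:
  assumes "norm q < 1"
  shows "durfee_term q m s sums durfee_sum q m s"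
  unfolding durfee_sum_def using summable_norm_cancel[OF summable_norm_durfee_term[OF assms]]
  by (rule summable_sums)

text \<open>The geometric majorant does not depend on m or s. This uniformity is what makes the
  iteration in \<open>durfee_sum_diag_Suc\<close> force a zero.\<close>

lemma durfee_sum_bounded:
  assumes "norm q < 1"
  obtains B where "\<And>m s. norm (durfee_sum q m s) \<le> B"
proof -
  obtain C where C: "\<And>m s i. norm (durfee_term q m s i) \<le> C * norm q ^ i"
    using durfee_term_le_geometric[OF assms] by blast
  show ?thesis
  proof
    show "norm (durfee_sum q m s) \<le> (\<Sum>i. C * norm q ^ i)" for m s
      unfolding durfee_sum_def using assms
      by (intro norm_suminf_le C summable_mult summable_geometric) auto
  qed
qed

text \<open>Termwise, the difference produces a factor 1 - q^i, which kills the term i = 0 and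
  otherwise cancels the last factor of (q;q)_i. Replacing i by i + 1 then leaves a series of the
  same type.\<close>

lemma durfee_sum_diff_shift:
  assumes "norm q < 1"
  shows "durfee_sum q m s - durfee_sum q m (s + 1) = q ^ (s + 1) * durfee_sum q (m + 1) (s + 2)"
proof -
  let ?d = "\<lambda>i. durfee_term q m s i - durfee_term q m (s + 1) i"
  have "?d sums (durfee_sum q m s - durfee_sum q m (s + 1))"
    by (intro sums_diff durfee_term_sums assms)
  moreover have "?d 0 = 0"
    by (simp add: durfee_term_def)
  moreover have "?d (Suc i) = q ^ (s + 1) * durfee_term q (m + 1) (s + 2) i" for i
  proof -
    define A where "A = qpoch q q i"
    define B where "B = qpoch q q (Suc (i + m))"
    define P where "P = q ^ ((Suc i)\<^sup>2 + Suc i * s)"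
    have nz: "A \<noteq> 0" "B \<noteq> 0" "1 - q * q ^ i \<noteq> 0"
      using qpoch_nonzero[OF assms] power_neq_1[OF assms, of "Suc i"] by (auto simp: A_def B_def)
    have "?d (Suc i) = (P - P * (q * q ^ i)) / (A * (1 - q * q ^ i) * B)"
      by (simp add: durfee_term_def A_def B_def P_def qpoch_Suc[of _ _ i] diff_divide_distrib power_add)
    also have "\<dots> = P / (A * B)"
      using nz by (simp add: divide_simps) (simp add: algebra_simps)
    also have "P = q ^ (s + 1) * q ^ (i\<^sup>2 + i * (s + 2))"
    proof -
      have "(Suc i)\<^sup>2 + Suc i * s = (s + 1) + (i\<^sup>2 + i * (s + 2))"
        by (simp add: power2_eq_square algebra_simps)
      then show ?thesis unfolding P_def by (simp only: power_add)
    qed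
    finally show ?thesis
      by (simp add: durfee_term_def A_def B_def)
  qed
  ultimately have "(\<lambda>i. q ^ (s + 1) * durfee_term q (m + 1) (s + 2) i)
      sums (durfee_sum q m s - durfee_sum q m (s + 1))"
    using sums_Suc_iff[of ?d "durfee_sum q m s - durfee_sum q m (s + 1)"] by simp
  then show ?thesis
    using sums_mult[OF durfee_term_sums[OF assms], of "q ^ (s + 1)" "m + 1" "s + 2"] sums_unique2 by blast
qed

text \<open>This holds term by term: with n = i + m, 1 / (q;q)_n = (1 - q^(n+1)) / (q;q)_(n+1), and
  the factor q^i inside q^(n+1) raises s by one.\<close>

lemma durfee_sum_Suc_left:
  assumes "norm q < 1"
  shows "durfee_sum q m s = durfee_sum q (m + 1) s - q ^ (m + 1) * durfee_sum q (m + 1) (s + 1)"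
proof -
  have "durfee_term q m s i = durfee_term q (m + 1) s i - q ^ (m + 1) * durfee_term q (m + 1) (s + 1) i" for i
  proof -
    define A where "A = qpoch q q i"
    define B where "B = qpoch q q (i + m)"
    have nz: "A \<noteq> 0" "B \<noteq> 0" "1 - q * q ^ (i + m) \<noteq> 0"
      using qpoch_nonzero[OF assms] power_neq_1[OF assms, of "Suc (i + m)"] by (auto simp: A_def B_def)
    show ?thesis using nz
      by (simp add: durfee_term_def qpoch_Suc divide_simps flip: A_def B_def)
         (simp add: algebra_simps power_add)
  qed
  then have "durfee_term q m s sums (durfee_sum q (m + 1) s - q ^ (m + 1) * durfee_sum q (m + 1) (s + 1))"
    using sums_diff[OF durfee_term_sums[OF assms] sums_mult[OF durfee_term_sums[OF assms]]] by presburger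
  then show ?thesis
    using durfee_term_sums[OF assms] sums_unique2 by blast
qed

section \<open>Cauchy's identity\<close>

lemma durfee_sum_diag_Suc:
  assumes "norm q < 1"
  shows "durfee_sum q m m = durfee_sum q (m + 1) (m + 1)"
proof -
  define D where "D = (\<lambda>m. durfee_sum q m m - durfee_sum q (m + 1) (m + 1))"
  \<comment> \<open>Writing G for \<open>durfee_sum q\<close>, the relations give G(m,m) = G(m+1,m)
    - q^(m+1) G(m+1,m+1) and G(m+1,m) - G(m+1,m+1) = q^(m+1) G(m+2,m+2). Eliminating G(m+1,m) leaves
    only diagonal values.\<close>
  have step: "D m = - (q ^ (m + 1) * D (m + 1))" for m
    using durfee_sum_Suc_left[OF assms, of m m] durfee_sum_diff_shift[OF assms, of "m + 1" m]
    by (simp add: D_def algebra_simps)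
  have norm_step: "norm (D m) \<le> norm q * norm (D (m + 1))" for m
  proof -
    have "norm (D m) = norm (q ^ (m + 1)) * norm (D (m + 1))"
      by (subst step) (simp add: norm_mult)
    also have "\<dots> \<le> norm q ^ 1 * norm (D (m + 1))"
      by (intro mult_right_mono norm_power_le_power assms) auto
    finally show ?thesis by simp
  qed
  have iter: "norm (D m) \<le> norm q ^ n * norm (D (m + n))" for n
  proof (induction n)
    case (Suc n)
    have "norm (D m) \<le> norm q ^ n * (norm q * norm (D (m + n + 1)))"
      by (rule order_trans[OF Suc.IH]) (intro mult_left_mono norm_step, simp)
    then show ?case by (simp add: mult_ac)
  qed simp
  obtain B where B: "\<And>m s. norm (durfee_sum q m s) \<le> B"
    using durfee_sum_bounded[OF assms] by blast
  have DB: "norm (D m) \<le> B + B" for m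
    unfolding D_def by (intro order_trans[OF norm_triangle_ineq4] add_mono B)
  have "norm (D m) \<le> norm q ^ n * (B + B)" for n
    by (rule order_trans[OF iter[of n]]) (intro mult_left_mono DB, simp)
  moreover have "(\<lambda>n. norm q ^ n * (B + B)) \<longlonglongrightarrow> 0"
    using assms by (intro tendsto_mult_left_zero LIMSEQ_power_zero) auto
  ultimately have "norm (D m) \<le> 0"
    by (intro LIMSEQ_le_const) auto
  then show ?thesis by (simp add: D_def)
qed

text \<open>The \<open>i = 0\<close> term is \<open>1 / (q;q)\<^sub>m\<close> and the rest is \<open>O(q^m)\<close>.\<close>

lemma durfee_sum_diag:
  assumes "norm q < 1"
  shows "durfee_sum q m m = 1 / qpoch_inf q q"
proof -
  define G where "G = durfee_sum q 0 0"
  have const: "durfee_sum q n n = G" for n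
  proof (induction n)
    case (Suc n)
    show ?case
      using durfee_sum_diag_Suc[OF assms, of n] Suc.IH by simp
  qed (simp add: G_def)
  obtain C where C: "\<forall>m s i e. e \<le> i ^ 2 + i * s \<longrightarrow> norm (durfee_term q m s i) \<le> C * norm q ^ e"
    using durfee_term_bounded[OF assms] by blast
  \<comment> \<open>Since (i+1)^2 + (i+1)s is at least s + i, every term beyond the first carries a
    factor |q|^s, and what remains is still summable in i.\<close>
  have C': "norm (durfee_term q m s (Suc i)) \<le> norm q ^ s * (C * norm q ^ i)" for m s i
  proof -
    have "norm (durfee_term q m s (Suc i)) \<le> C * norm q ^ (s + i)"
      by (rule C[rule_format]) (simp add: power2_eq_square)
    then show ?thesis by (simp add: power_add mult_ac)
  qed
  define S where "S = (\<Sum>i. C * norm q ^ i)"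
  have "norm (durfee_sum q n n - 1 / qpoch q q n) \<le> norm q ^ n * S" for n
  proof -
    have sm: "summable (\<lambda>i. C * norm q ^ i)"
      using assms by (intro summable_mult summable_geometric) auto
    have "durfee_term q n n 0 = 1 / qpoch q q n"
      by (simp add: durfee_term_def)
    then have "durfee_sum q n n - 1 / qpoch q q n = (\<Sum>i. durfee_term q n n (Suc i))"
      using suminf_split_head[OF sums_summable[OF durfee_term_sums[OF assms, of n n]]]
      by (simp only: durfee_sum_def)
    also have "norm \<dots> \<le> (\<Sum>i. norm q ^ n * (C * norm q ^ i))"
      by (rule norm_suminf_le[OF C' summable_mult[OF sm]])
    also have "\<dots> = norm q ^ n * S"
      unfolding S_def by (rule suminf_mult[OF sm])
    finally show ?thesis .
  qed
  moreover have "(\<lambda>n. norm q ^ n * S) \<longlonglongrightarrow> 0"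
    using assms by (intro tendsto_mult_left_zero LIMSEQ_power_zero) auto
  ultimately have "(\<lambda>n. durfee_sum q n n - 1 / qpoch q q n) \<longlonglongrightarrow> 0"
    by (rule Lim_null_comparison[OF always_eventually[OF allI]])
  then have "(\<lambda>n. (durfee_sum q n n - 1 / qpoch q q n) + 1 / qpoch q q n) \<longlonglongrightarrow> 0 + 1 / qpoch_inf q q"
    by (intro tendsto_add inverse_qpoch_tendsto assms)
  then have "(\<lambda>n::nat. G) \<longlonglongrightarrow> 1 / qpoch_inf q q"
    by (simp add: const)
  then show ?thesis
    by (metis LIMSEQ_const_iff const)
qed

section \<open>Dominated double sums, rearranged along diagonals\<close>

lemma summable_product_dominated:
  fixes F :: "nat \<Rightarrow> nat \<Rightarrow> complex"
  assumes "summable (a :: nat \<Rightarrow> real)" "summable (b :: nat \<Rightarrow> real)"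
    and bound: "\<And>i m. norm (F i m) \<le> b i * a m"
    and nonneg: "\<And>m. 0 \<le> a m" "\<And>i. 0 \<le> b i"
  shows "(\<lambda>(i, m). F i m) summable_on UNIV \<times> UNIV"
proof -
  have a: "a summable_on UNIV" and b: "b summable_on UNIV"
    using assms by (auto simp: summable_on_UNIV_nonneg_real_iff)
  have ab: "(\<lambda>(i, m). b i * a m) summable_on UNIV \<times> UNIV"
    by (rule summable_on_SigmaI[where g = "\<lambda>i. b i * infsum a UNIV"])
       (use nonneg in \<open>auto intro!: has_sum_cmult_right has_sum_infsum a summable_on_cmult_left b\<close>)
  show ?thesis
    by (rule abs_summable_summable, rule Infinite_Sum.abs_summable_on_comparison_test'[OF ab]) (use bound in auto)
qed

text \<open>In each row substitute j = i + m. As w vanishes below k, m may range over all naturals,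
  so the domain becomes a full product on which the sums can be interchanged. The weight depends on
  the diagonal m alone and leaves the inner sum.\<close>

lemma
  fixes w :: "nat \<Rightarrow> complex"
  assumes w: "\<And>m. m < k \<Longrightarrow> w m = 0"
    and summ: "(\<lambda>(i, m). w m * u i (i + m)) summable_on UNIV \<times> UNIV"
  shows summable_on_row: "(\<lambda>j. w (j - i) * u i j) summable_on {i + k..}"
    and summable_on_rows: "(\<lambda>i. \<Sum>\<^sub>\<infinity>j\<in>{i + k..}. w (j - i) * u i j) summable_on UNIV"
    and infsum_rows_eq_diagonals:
      "(\<Sum>\<^sub>\<infinity>i. \<Sum>\<^sub>\<infinity>j\<in>{i + k..}. w (j - i) * u i j) = (\<Sum>\<^sub>\<infinity>m. w m * (\<Sum>\<^sub>\<infinity>i. u i (i + m)))"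
proof -
  have bij: "bij_betw ((+) i) {k..} {i + k..}" for i :: nat
    by (rule bij_betwI[where g = "\<lambda>j. j - i"]) auto
  have row: "(\<lambda>m. w m * u i (i + m)) summable_on UNIV" for i
    using summable_on_SigmaD1[of "\<lambda>i m. w m * u i (i + m)" UNIV "\<lambda>_. UNIV" i] summ by simp
  have "(\<lambda>m. w m * u i (i + m)) summable_on {k..}" for i
    by (rule summable_on_subset_banach[OF row]) simp
  then show "(\<lambda>j. w (j - i) * u i j) summable_on {i + k..}"
    using summable_on_reindex_bij_betw[OF bij, of "\<lambda>j. w (j - i) * u i j" i] by simp
  have eq: "(\<Sum>\<^sub>\<infinity>j\<in>{i + k..}. w (j - i) * u i j) = (\<Sum>\<^sub>\<infinity>m. w m * u i (i + m))" for i
  proof -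
    have "(\<Sum>\<^sub>\<infinity>j\<in>{i + k..}. w (j - i) * u i j) = (\<Sum>\<^sub>\<infinity>m\<in>{k..}. w m * u i (i + m))"
      using infsum_reindex_bij_betw[OF bij, of "\<lambda>j. w (j - i) * u i j" i] by simp
    also have "\<dots> = (\<Sum>\<^sub>\<infinity>m. w m * u i (i + m))"
      by (rule infsum_cong_neutral) (use w in \<open>auto simp: not_le\<close>)
    finally show ?thesis .
  qed
  show "(\<lambda>i. \<Sum>\<^sub>\<infinity>j\<in>{i + k..}. w (j - i) * u i j) summable_on UNIV"
    unfolding eq using summable_on_Sigma_banach[of "\<lambda>i m. w m * u i (i + m)" UNIV "\<lambda>_. UNIV"] summ by simp
  show "(\<Sum>\<^sub>\<infinity>i. \<Sum>\<^sub>\<infinity>j\<in>{i + k..}. w (j - i) * u i j) = (\<Sum>\<^sub>\<infinity>m. w m * (\<Sum>\<^sub>\<infinity>i. u i (i + m)))"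
    unfolding eq using infsum_swap_banach[OF summ] by (simp add: infsum_cmult_right')
qed

section \<open>The binomial weights and their partial sums\<close>

text \<open>Up to sign these are coefficients of Chebyshev-type polynomials, whence the names.\<close>

definition cheb_weight :: "nat \<Rightarrow> nat \<Rightarrow> real" where
  "cheb_weight k n = real n / real k * real ((n + k - 1) choose (2 * k - 1))"

definition cheb_partial :: "nat \<Rightarrow> nat \<Rightarrow> real" where
  "cheb_partial k n = real (2 * n + 1) / real (2 * k + 1) * real ((n + k) choose (2 * k))"

text \<open>Absorption turns the weight on the right-hand sides into the one on the left of the
  second identity, which is why that identity needs no summation by parts.\<close>

lemma cheb_weight_alt:
  assumes "k \<ge> 1"
  shows "cheb_weight k n = real (2 * n) / real (n + k) * real ((n + k) choose (2 * k))"
proof -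
  have "2 * k * ((n + k) choose (2 * k)) = (n + k) * ((n + k - 1) choose (2 * k - 1))"
    by (rule times_binomial_minus1_eq) (use assms in simp)
  then have "2 * real k * real ((n + k) choose (2 * k)) = real (n + k) * real ((n + k - 1) choose (2 * k - 1))"
    by (metis of_nat_mult of_nat_numeral)
  moreover have "real k > 0" "real (n + k) > 0"
    using assms by auto
  ultimately have "real ((n + k - 1) choose (2 * k - 1)) = 2 * real k * real ((n + k) choose (2 * k)) / real (n + k)"
    by (metis nonzero_mult_div_cancel_left less_irrefl)
  then show ?thesis
    using \<open>real k > 0\<close> by (simp add: cheb_weight_def)
qed

lemma cheb_weight_eq_0: "n < k \<Longrightarrow> cheb_weight k n = 0"
  by (cases "n = 0") (auto simp: cheb_weight_def)

lemma cheb_partial_eq_0: "n < k \<Longrightarrow> cheb_partial k n = 0"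
  by (simp add: cheb_partial_def)

text \<open>Pascal's rule expresses all three binomials through two neighbours a and b. Absorption
  links these by 2k a = (n - k + 1) b, and the claim becomes a linear consequence of that
  relation.\<close>

lemma cheb_partial_Suc:
  assumes "k \<ge> 1"
  shows "cheb_partial k (Suc n) = cheb_partial k n + cheb_weight k (Suc n)"
\<comment> \<open>Splitting at n + 1 rather than n puts n = k - 1 into the general case, where n + k
  - (2k - 1) is still an untruncated subtraction.\<close>
proof (cases "Suc n < k")
  case False
  define a where "a = real ((n + k) choose (2 * k))"
  define b where "b = real ((n + k) choose (2 * k - 1))"
  obtain l where l: "2 * k = Suc l" "l = 2 * k - 1"
    using assms by (cases k) auto
  have pascal: "real ((Suc n + k) choose (2 * k)) = a + b"
    unfolding a_def b_def l(1) by simp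
  have "2 * k * ((n + k) choose (2 * k)) = (n + k - l) * ((n + k) choose l)"
    unfolding l(1) by (simp only: binomial_absorb_comp binomial_absorption)
  then have "2 * real k * a = real (n + k - l) * b"
    unfolding a_def b_def l(2) by (metis of_nat_mult of_nat_numeral)
  also have "real (n + k - l) = real n - real k + 1"
    using False assms l(2) by (auto simp: of_nat_diff)
  finally have ab: "2 * real k * a = (real n - real k + 1) * b" .
  have "real k > 0" using assms by simp
  have e0: "cheb_partial k (Suc n) = (2 * real n + 3) / (2 * real k + 1) * (a + b)"
    unfolding cheb_partial_def pascal by (simp add: algebra_simps)
  have e1: "cheb_partial k n = (2 * real n + 1) / (2 * real k + 1) * a"
    by (simp add: cheb_partial_def a_def add.commute)
  have e2: "cheb_weight k (Suc n) = (real n + 1) / real k * b"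
    by (simp add: cheb_weight_def b_def add.commute)
  have key: "(2 * real n + 3) * (a + b) * real k
      = (2 * real n + 1) * a * real k + (real n + 1) * b * (2 * real k + 1)"
    using ab by (simp add: algebra_simps)
  have nz: "2 * real k + 1 \<noteq> 0" "real k \<noteq> 0"
    using \<open>real k > 0\<close> by linarith+
  show ?thesis
    unfolding e0 e1 e2 using key nz by (simp add: divide_simps)
qed (simp add: cheb_partial_eq_0 cheb_weight_eq_0)

lemma cheb_weight_nonneg: "cheb_weight k n \<ge> 0"
  by (simp add: cheb_weight_def)

lemma cheb_partial_nonneg: "cheb_partial k n \<ge> 0"
  by (simp add: cheb_partial_def)

text \<open>The weight is the last increment of a nonnegative partial sum. Hence a single majorant
  \<open>cheb_partial\<close> serves both kinds of weight.\<close>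

lemma cheb_weight_le_partial:
  assumes "k \<ge> 1"
  shows "cheb_weight k n \<le> cheb_partial k n"
proof (cases n)
  case 0
  then show ?thesis using cheb_partial_nonneg by (simp add: cheb_weight_def)
next
  case (Suc m)
  then show ?thesis using cheb_partial_Suc[OF assms, of m] cheb_partial_nonneg[of k m] by simp
qed

section \<open>Convergence of power series with polynomially growing weights\<close>

text \<open>Induction on p by termwise differentiation: differentiating the series with coefficients
  (n+1)^p gives (n+1)(n+2)^p, which dominates (n+1)^(p+1). The radius stays arbitrary because
  differentiation uses convergence throughout the unit disc.\<close>

lemma summable_poly_times_power:
  fixes r :: real
  assumes "norm r < 1"
  shows "summable (\<lambda>n. real (Suc n) ^ p * r ^ n)"
  using assms
proof (induction p arbitrary: r)
  case 0
  then show ?case by (simp add: summable_geometric)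
next
  case (Suc p)
  have "summable (\<lambda>n. diffs (\<lambda>n. real (Suc n) ^ p) n * \<bar>r\<bar> ^ n)"
    by (rule termdiff_converges[where K = 1]) (use Suc in auto)
  then show ?case
  proof (rule summable_comparison_test'[where N = 0])
    fix n
    have "norm (real (Suc n) ^ Suc p * r ^ n) = real (Suc n) * real (Suc n) ^ p * \<bar>r\<bar> ^ n"
      by (simp only: real_norm_def abs_mult power_abs abs_of_nat power_Suc)
    also have "\<dots> \<le> real (Suc n) * real (Suc (Suc n)) ^ p * \<bar>r\<bar> ^ n"
      by (intro mult_mono power_mono) auto
    finally show "norm (real (Suc n) ^ Suc p * r ^ n) \<le> diffs (\<lambda>n. real (Suc n) ^ p) n * \<bar>r\<bar> ^ n"
      by (simp only: diffs_def)
  qed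
qed

lemma summable_cheb_partial:
  assumes "0 \<le> r" "r < 1"
  shows "summable (\<lambda>n. cheb_partial k n * r ^ n)"
proof -
  \<comment> \<open>The constants come from n + k \<le> (k+1)(n+1), from bounding the binomial by
    (n+k)^(2k), and from (2n+1)/(2k+1) \<le> 2(n+1).\<close>
  have le: "cheb_partial k n \<le> 2 * real (Suc k) ^ (2 * k) * real (Suc n) ^ Suc (2 * k)" for n
  proof (cases "n < k")
    case False
    have "real ((n + k) choose (2 * k)) \<le> real (n + k) ^ (2 * k)"
      using of_nat_mono[OF binomial_le_pow[of "2 * k" "n + k"], where 'a = real] False by simp
    also have "\<dots> \<le> (real (Suc k) * real (Suc n)) ^ (2 * k)"
      by (intro power_mono) (auto simp: algebra_simps)
    finally have 1: "real ((n + k) choose (2 * k)) \<le> (real (Suc k) * real (Suc n)) ^ (2 * k)" .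
    have "real (2 * n + 1) / real (2 * k + 1) \<le> real (2 * n + 1) / 1"
      by (intro divide_left_mono) auto
    then have 2: "real (2 * n + 1) / real (2 * k + 1) \<le> 2 * real (Suc n)"
      by simp
    have "cheb_partial k n \<le> 2 * real (Suc n) * (real (Suc k) * real (Suc n)) ^ (2 * k)"
      unfolding cheb_partial_def by (intro mult_mono 1 2) auto
    then show ?thesis by (simp add: power_mult_distrib mult_ac del: of_nat_Suc)
  qed (simp add: cheb_partial_eq_0)
  show ?thesis
  proof (rule summable_comparison_test'[where N = 0])
    show "summable (\<lambda>n. 2 * real (Suc k) ^ (2 * k) * (real (Suc n) ^ Suc (2 * k) * r ^ n))"
      by (intro summable_mult summable_poly_times_power) (use assms in auto)
    show "norm (cheb_partial k n * r ^ n) \<le> 2 * real (Suc k) ^ (2 * k) * (real (Suc n) ^ Suc (2 * k) * r ^ n)" for n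
      using mult_right_mono[OF le, of "r ^ n" n] assms cheb_partial_nonneg[of k n]
      by (simp add: abs_mult mult.assoc)
  qed
qed

section \<open>Weighted series: evaluation of the double sum and summation by parts\<close>

lemma infsum_eq_sums:
  fixes f :: "nat \<Rightarrow> 'a::banach"
  assumes "summable (\<lambda>n. norm (f n))" "f sums S"
  shows "infsum f UNIV = S"
  by (rule infsumI[OF norm_summable_imp_has_sum[OF assms]])

lemma summable_norm_weighted:
  assumes "0 \<le> r" "r < 1"
    and "\<And>m. norm (w m :: complex) \<le> cheb_partial k m" "\<And>m. norm (c m) \<le> B * r ^ m"
  shows "summable (\<lambda>m. norm (w m * c m))"
proof (rule summable_comparison_test'[where N = 0])
  show "summable (\<lambda>m. B * (cheb_partial k m * r ^ m))"
    by (intro summable_mult summable_cheb_partial assms)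
  have "norm (w m * c m) \<le> cheb_partial k m * (B * r ^ m)" for m
    unfolding norm_mult by (intro mult_mono assms cheb_partial_nonneg) auto
  then show "norm (norm (w m * c m)) \<le> B * (cheb_partial k m * r ^ m)" for m
    by (simp add: mult_ac)
qed

text \<open>Stated once for both identities, with r = |q|. The first takes Q = q, s m = m + 1, p m =
  q^(m(m+1)/2); the second takes Q = q^2, s m = m, p m = q^(m^2).\<close>

lemma
  assumes Q: "norm Q < 1" and r: "0 \<le> r" "r < 1" and k: "k \<ge> 1"
    and w: "\<And>m. norm (w m) = cheb_weight k m"
    and p: "\<And>m. norm (p m) \<le> r ^ m"
    and u: "\<And>i m. u i (i + m) = p m * durfee_term Q m (s m) i"
  shows summable_on_weighted_row: "(\<lambda>j. w (j - i) * u i j) summable_on {i + k..}"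
    and summable_on_weighted_rows: "(\<lambda>i. \<Sum>\<^sub>\<infinity>j\<in>{i + k..}. w (j - i) * u i j) summable_on UNIV"
    and infsum_weighted_rows: "(\<Sum>\<^sub>\<infinity>i. \<Sum>\<^sub>\<infinity>j\<in>{i + k..}. w (j - i) * u i j)
      = (\<Sum>\<^sub>\<infinity>m. w m * (p m * durfee_sum Q m (s m)))"
proof -
  obtain C where C: "\<And>m s i. norm (durfee_term Q m s i) \<le> C * norm Q ^ i"
    using durfee_term_le_geometric[OF Q] by blast
  have C0: "0 \<le> C"
    using C[of 0 0 0] by (simp add: order_trans[OF norm_ge_zero])
  have w0: "w m = 0" if "m < k" for m
    using w[of m] cheb_weight_eq_0[OF that] by simp
  have "norm (w m * u i (i + m)) \<le> (C * norm Q ^ i) * (cheb_partial k m * r ^ m)" for i m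
  proof -
    have "norm (w m * u i (i + m)) = cheb_weight k m * norm (p m) * norm (durfee_term Q m (s m) i)"
      by (simp add: u norm_mult w)
    also have "\<dots> \<le> cheb_partial k m * r ^ m * (C * norm Q ^ i)"
      using r C0 by (intro mult_mono cheb_weight_le_partial k p C cheb_partial_nonneg mult_nonneg_nonneg) auto
    finally show ?thesis by (simp add: mult_ac)
  qed
  then have summ: "(\<lambda>(i, m). w m * u i (i + m)) summable_on UNIV \<times> UNIV"
    using Q r C0
    by (intro summable_product_dominated[where a = "\<lambda>m. cheb_partial k m * r ^ m" and b = "\<lambda>i. C * norm Q ^ i"]
          summable_cheb_partial summable_mult summable_geometric mult_nonneg_nonneg cheb_partial_nonneg) auto
  note rows = summable_on_row[OF w0 summ] summable_on_rows[OF w0 summ] infsum_rows_eq_diagonals[OF w0 summ]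
  show "(\<lambda>j. w (j - i) * u i j) summable_on {i + k..}"
    "(\<lambda>i. \<Sum>\<^sub>\<infinity>j\<in>{i + k..}. w (j - i) * u i j) summable_on UNIV"
    using rows by blast+
  have "(\<Sum>\<^sub>\<infinity>i. u i (i + m)) = p m * durfee_sum Q m (s m)" for m
    unfolding u infsum_cmult_right'
    by (simp add: infsum_eq_sums[OF summable_norm_durfee_term durfee_term_sums] Q)
  then show "(\<Sum>\<^sub>\<infinity>i. \<Sum>\<^sub>\<infinity>j\<in>{i + k..}. w (j - i) * u i j)
      = (\<Sum>\<^sub>\<infinity>m. w m * (p m * durfee_sum Q m (s m)))"
    using rows(3) by simp
qed

text \<open>The sign alternates, so the difference of partial sums turns into \<open>c m + c (Suc m)\<close>.\<close>

lemma infsum_summation_by_parts: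
  fixes c :: "nat \<Rightarrow> complex" and sg :: "nat \<Rightarrow> complex"
  assumes r: "0 \<le> r" "r < 1" and k: "k \<ge> 1" and c: "\<And>m. norm (c m) \<le> B * r ^ m"
  defines "sg \<equiv> \<lambda>m. (-1) ^ (m - k)"
  shows "(\<Sum>\<^sub>\<infinity>m. sg m * of_real (cheb_weight k m) * c m)
       = (\<Sum>\<^sub>\<infinity>m. sg m * of_real (cheb_partial k m) * (c m + c (Suc m)))"
proof -
  define f where "f = (\<lambda>m. sg m * of_real (cheb_partial k m) * c m)"
  define g where "g = (\<lambda>m. sg m * of_real (cheb_partial k m) * c (Suc m))"
  define h where "h = (\<lambda>m. sg m * of_real (cheb_weight k m) * c m)"
  have sg: "norm (sg m) = 1" for m
    by (simp add: sg_def norm_power)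
  have B0: "B \<ge> 0"
    using c[of 0] by (simp add: order_trans[OF norm_ge_zero])
  have c': "norm (c (Suc m)) \<le> B * r ^ m" for m
    using r B0 by (intro order_trans[OF c] mult_left_mono power_decreasing) auto
  have V: "norm (sg m * of_real (cheb_partial k m)) \<le> cheb_partial k m" for m
    by (simp add: norm_mult sg cheb_partial_nonneg)
  have W: "norm (sg m * of_real (cheb_weight k m)) \<le> cheb_partial k m" for m
    using cheb_weight_le_partial[OF k] by (simp add: norm_mult sg cheb_weight_nonneg)
  have "norm (c m + c (Suc m)) \<le> 2 * B * r ^ m" for m
    using norm_triangle_mono[OF c c', of m m] by simp
  then have nfg: "summable (\<lambda>m. norm (sg m * of_real (cheb_partial k m) * (c m + c (Suc m))))"
    by (rule summable_norm_weighted[OF r V])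
  have nf: "summable (\<lambda>m. norm (f m))"
    unfolding f_def by (rule summable_norm_weighted[OF r V c])
  have ng: "summable (\<lambda>m. norm (g m))"
    unfolding g_def by (rule summable_norm_weighted[OF r V c'])
  have nh: "summable (\<lambda>m. norm (h m))"
    unfolding h_def by (rule summable_norm_weighted[OF r W c])
  have f: "f sums suminf f" and g: "g sums suminf g"
    using nf ng summable_norm_cancel summable_sums by blast+
  \<comment> \<open>Positivity of k makes the zeroth terms vanish, so the index shifts below lose
    nothing.\<close>
  have f0: "f 0 = 0" and h0: "h 0 = 0"
    using k by (simp_all add: f_def h_def cheb_partial_eq_0 cheb_weight_eq_0)
  \<comment> \<open>For m \<ge> k the sign flips from m to m + 1, matching the difference of partial
    sums. For m < k truncated subtraction keeps the sign constant, but there the partial sum at m is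
    zero.\<close>
  have "h (Suc m) = f (Suc m) + g m" for m
  proof (cases "m < k")
    case True
    then show ?thesis
      using cheb_partial_Suc[OF k, of m] by (simp add: f_def g_def h_def cheb_partial_eq_0)
  next
    case False
    then have "sg (Suc m) = - sg m"
      by (simp add: sg_def Suc_diff_le)
    then show ?thesis
      using cheb_partial_Suc[OF k, of m] by (simp add: f_def g_def h_def algebra_simps)
  qed
  moreover have "(\<lambda>m. f (Suc m)) sums suminf f"
    using f f0 by (simp add: sums_Suc_iff)
  ultimately have "(\<lambda>m. h (Suc m)) sums (suminf f + suminf g)"
    using sums_add[OF _ g] by simp
  then have "h sums (suminf f + suminf g)"
    using h0 by (simp add: sums_Suc_iff)
  moreover have "(\<lambda>m. sg m * of_real (cheb_partial k m) * (c m + c (Suc m))) sums (suminf f + suminf g)"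
    using sums_add[OF f g] by (simp add: f_def g_def distrib_left)
  ultimately show ?thesis
    using infsum_eq_sums[OF nh] infsum_eq_sums[OF nfg] by (simp add: h_def)
qed

section \<open>Splitting the exponents, and the two identities\<close>

text \<open>With j = i + m, the exponent of the first double sum separates into a part depending on
  m only and the exponent of \<open>durfee_term\<close> with s = m + 1. Doubling both sides removes
  the divisions.\<close>

lemma triangle_add:
  "i * (i + 1) div 2 + (i + m) * (i + m + 1) div 2 = m * (m + 1) div 2 + (i\<^sup>2 + i * (m + 1))" for i m :: nat
proof -
  have t: "2 * (n * (n + 1) div 2) = n * (n + 1)" for n :: nat
    by (rule dvd_mult_div_cancel) simp
  have "2 * (i * (i + 1) div 2 + (i + m) * (i + m + 1) div 2) = 2 * (m * (m + 1) div 2 + (i\<^sup>2 + i * (m + 1)))"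
    unfolding add_mult_distrib2[of 2] t by (simp add: power2_eq_square algebra_simps)
  then show ?thesis
    by (rule iffD1[OF mult_left_cancel, rotated]) simp
qed

theorem theorem2p3:
  fixes q :: complex and k :: nat
  assumes "norm q < 1" and "k \<ge> 1"
  shows "(
     (\<lambda>n. (-1) ^ (n - k) * (of_nat (2 * n + 1) / of_nat (2 * k + 1)) * of_nat ((n + k) choose (2 * k))
          * q ^ (n * (n + 1) div 2)) summable_on {k..} \<and>
     (\<forall>i. (\<lambda>j. (-1) ^ (j - i - k) * (of_nat (j - i) / of_nat k) * of_nat ((j - i + k - 1) choose (2 * k - 1))
          * (q ^ (i * (i + 1) div 2 + j * (j + 1) div 2) / (qpoch q q i * qpoch q q j))) summable_on {i+k..}) \<and>
     (\<lambda>i. \<Sum>\<^sub>\<infinity>j\<in>{i+k..}. (-1) ^ (j - i - k) * (of_nat (j - i) / of_nat k) * of_nat ((j - i + k - 1) choose (2 * k - 1))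
          * (q ^ (i * (i + 1) div 2 + j * (j + 1) div 2) / (qpoch q q i * qpoch q q j))) summable_on UNIV \<and>
     1 / qpoch_inf q q *
          (\<Sum>\<^sub>\<infinity>n\<in>{k..}. (-1) ^ (n - k) * (of_nat (2 * n + 1) / of_nat (2 * k + 1)) * of_nat ((n + k) choose (2 * k))
          * q ^ (n * (n + 1) div 2))
       = (\<Sum>\<^sub>\<infinity>i. \<Sum>\<^sub>\<infinity>j\<in>{i+k..}. (-1) ^ (j - i - k) * (of_nat (j - i) / of_nat k) * of_nat ((j - i + k - 1) choose (2 * k - 1))
          * (q ^ (i * (i + 1) div 2 + j * (j + 1) div 2) / (qpoch q q i * qpoch q q j)))) \<and>
    (
     (\<lambda>n. (-1) ^ (n - k) * (of_nat (2 * n) / of_nat (n + k)) * of_nat ((n + k) choose (2 * k))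
          * q ^ (n ^ 2)) summable_on {k..} \<and>
     (\<forall>i. (\<lambda>j. (-1) ^ (j - i - k) * (of_nat (j - i) / of_nat k) * of_nat ((j - i + k - 1) choose (2 * k - 1))
          * (q ^ (i ^ 2 + j ^ 2) / (qpoch (q ^ 2) (q ^ 2) i * qpoch (q ^ 2) (q ^ 2) j))) summable_on {i+k..}) \<and>
     (\<lambda>i. \<Sum>\<^sub>\<infinity>j\<in>{i+k..}. (-1) ^ (j - i - k) * (of_nat (j - i) / of_nat k) * of_nat ((j - i + k - 1) choose (2 * k - 1))
          * (q ^ (i ^ 2 + j ^ 2) / (qpoch (q ^ 2) (q ^ 2) i * qpoch (q ^ 2) (q ^ 2) j))) summable_on UNIV \<and>
     1 / qpoch_inf (q ^ 2) (q ^ 2) *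
          (\<Sum>\<^sub>\<infinity>n\<in>{k..}. (-1) ^ (n - k) * (of_nat (2 * n) / of_nat (n + k)) * of_nat ((n + k) choose (2 * k))
          * q ^ (n ^ 2))
       = (\<Sum>\<^sub>\<infinity>i. \<Sum>\<^sub>\<infinity>j\<in>{i+k..}. (-1) ^ (j - i - k) * (of_nat (j - i) / of_nat k) * of_nat ((j - i + k - 1) choose (2 * k - 1))
          * (q ^ (i ^ 2 + j ^ 2) / (qpoch (q ^ 2) (q ^ 2) i * qpoch (q ^ 2) (q ^ 2) j))))"
proof -
  define sg :: "nat \<Rightarrow> complex" where "sg = (\<lambda>m. (-1) ^ (m - k))"
  have sg: "norm (sg m) = 1" for m
    by (simp add: sg_def norm_power)
  have r: "0 \<le> norm q" "norm q < 1" using assms by auto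
  have q2: "norm (q\<^sup>2) < 1"
    using assms by (simp add: norm_power power_less_one_iff)
  define w where "w = (\<lambda>m. sg m * of_real (cheb_weight k m))"
  define v where "v = (\<lambda>m. sg m * of_real (cheb_partial k m))"
  have w: "norm (w m) = cheb_weight k m" and v: "norm (v m) = cheb_partial k m" for m
    by (simp_all add: w_def v_def norm_mult sg cheb_weight_nonneg cheb_partial_nonneg)
  have w_eq: "(-1) ^ (m - k) * (of_nat m / of_nat k) * of_nat ((m + k - 1) choose (2 * k - 1)) = w m" for m
    by (simp add: w_def sg_def cheb_weight_def)
  have w_eq': "(-1) ^ (m - k) * (of_nat (2 * m) / of_nat (m + k)) * of_nat ((m + k) choose (2 * k)) = w m" for m
    by (simp add: w_def sg_def cheb_weight_alt[OF assms(2)])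
  have v_eq: "(-1) ^ (m - k) * (of_nat (2 * m + 1) / of_nat (2 * k + 1)) * of_nat ((m + k) choose (2 * k)) = v m" for m
    by (simp add: v_def sg_def cheb_partial_def)
  have w0: "w m = 0" and v0: "v m = 0" if "m < k" for m
    using that by (simp_all add: w_def v_def cheb_weight_eq_0 cheb_partial_eq_0)
  have wV: "norm (w m) \<le> cheb_partial k m" and vV: "norm (v m) \<le> cheb_partial k m" for m
    using cheb_weight_le_partial[OF assms(2)] by (simp_all add: w v)
  define p1 where "p1 = (\<lambda>m. q ^ (m * (m + 1) div 2))"
  define p2 where "p2 = (\<lambda>m. q ^ (m ^ 2))"
  have "m \<le> m * (m + 1) div 2" for m :: nat
    by (cases m) auto
  then have p1: "norm (p1 m) \<le> norm q ^ m" for m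
    unfolding p1_def by (intro norm_power_le_power assms)
  have "m \<le> m ^ 2" for m :: nat
    by (simp add: power2_eq_square)
  then have p2: "norm (p2 m) \<le> norm q ^ m" for m
    unfolding p2_def by (intro norm_power_le_power assms)
  have sumV: "(\<lambda>m. v m * p1 m) summable_on {k..}" and sumW: "(\<lambda>m. w m * p2 m) summable_on {k..}"
    using norm_summable_imp_summable_on[OF summable_norm_weighted[OF r vV, of p1 1]]
      norm_summable_imp_summable_on[OF summable_norm_weighted[OF r wV, of p2 1]] p1 p2
    by (auto intro: summable_on_subset_banach)
  define u1 where "u1 = (\<lambda>i j. q ^ (i * (i + 1) div 2 + j * (j + 1) div 2) / (qpoch q q i * qpoch q q j))"
  define u2 where "u2 = (\<lambda>i j. q ^ (i ^ 2 + j ^ 2) / (qpoch (q ^ 2) (q ^ 2) i * qpoch (q ^ 2) (q ^ 2) j))"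
  have u1: "u1 i (i + m) = p1 m * durfee_term q m (m + 1) i" for i m
    by (simp only: u1_def p1_def durfee_term_def triangle_add power_add[of q "m * (m + 1) div 2"] times_divide_eq_right)
  \<comment> \<open>Here the part depending on i is even, so its factor 2 passes into the base q^2,
    leaving s = m.\<close>
  have u2: "u2 i (i + m) = p2 m * durfee_term (q ^ 2) m m i" for i m
  proof -
    have "i ^ 2 + (i + m) ^ 2 = m ^ 2 + 2 * (i ^ 2 + i * m)"
      by (simp add: power2_eq_square algebra_simps)
    then show ?thesis
      by (simp only: u2_def p2_def durfee_term_def power_add[of q "m ^ 2"] power_mult[of q 2] times_divide_eq_right)
  qed
  note dbl1 = summable_on_weighted_row[OF assms(1) r assms(2) w p1 u1]
    summable_on_weighted_rows[OF assms(1) r assms(2) w p1 u1] infsum_weighted_rows[OF assms(1) r assms(2) w p1 u1]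
  note dbl2 = summable_on_weighted_row[OF q2 r assms(2) w p2 u2]
    summable_on_weighted_rows[OF q2 r assms(2) w p2 u2] infsum_weighted_rows[OF q2 r assms(2) w p2 u2]

  define c where "c = (\<lambda>m. p1 m * durfee_sum q m (m + 1))"
  obtain B where B: "\<And>m s. norm (durfee_sum q m s) \<le> B"
    using durfee_sum_bounded[OF assms(1)] by blast
  have c_le: "norm (c m) \<le> B * norm q ^ m" for m
    unfolding c_def norm_mult mult.commute[of B] by (intro mult_mono p1 B) auto
  \<comment> \<open>The step m + 1 between consecutive triangular numbers supplies exactly the power
    of q for which \<open>durfee_sum_diff_shift\<close> at s = m collapses the sum to the diagonal
    value, known from Cauchy's identity.\<close>
  have c_Suc: "c m + c (Suc m) = p1 m * (1 / qpoch_inf q q)" for m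
  proof -
    have "Suc m * (Suc m + 1) div 2 = m * (m + 1) div 2 + (m + 1)"
      using triangle_add[of 1 m] by simp
    then have "p1 (Suc m) = p1 m * q ^ (m + 1)"
      unfolding p1_def by (simp only: power_add)
    then have "c m + c (Suc m) = p1 m * (durfee_sum q m (m + 1) + q ^ (m + 1) * durfee_sum q (m + 1) (m + 2))"
      by (simp add: c_def algebra_simps)
    also have "durfee_sum q m (m + 1) + q ^ (m + 1) * durfee_sum q (m + 1) (m + 2) = durfee_sum q m m"
      using durfee_sum_diff_shift[OF assms(1), of m m] by (simp add: algebra_simps)
    finally show ?thesis by (simp only: durfee_sum_diag[OF assms(1)])
  qed
  have "(\<Sum>\<^sub>\<infinity>m. w m * c m) = (\<Sum>\<^sub>\<infinity>m. v m * (c m + c (Suc m)))"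
    using infsum_summation_by_parts[OF r assms(2) c_le] unfolding w_def v_def sg_def .
  also have "\<dots> = 1 / qpoch_inf q q * (\<Sum>\<^sub>\<infinity>m. v m * p1 m)"
    unfolding c_Suc infsum_cmult_right'[symmetric] by (intro infsum_cong) simp
  also have "(\<Sum>\<^sub>\<infinity>m. v m * p1 m) = (\<Sum>\<^sub>\<infinity>m\<in>{k..}. v m * p1 m)"
    by (rule infsum_cong_neutral) (auto simp: v0 not_le)
  finally have eq1: "1 / qpoch_inf q q * (\<Sum>\<^sub>\<infinity>m\<in>{k..}. v m * p1 m)
      = (\<Sum>\<^sub>\<infinity>i. \<Sum>\<^sub>\<infinity>j\<in>{i + k..}. w (j - i) * u1 i j)"
    unfolding dbl1(3) c_def by simp

  \<comment> \<open>Every diagonal already has s = m, so Cauchy's identity in base q^2 gives the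
    same constant for each m and it factors out.\<close>
  have "(\<Sum>\<^sub>\<infinity>m. w m * (p2 m * durfee_sum (q ^ 2) m m)) = 1 / qpoch_inf (q ^ 2) (q ^ 2) * (\<Sum>\<^sub>\<infinity>m. w m * p2 m)"
    unfolding durfee_sum_diag[OF q2] infsum_cmult_right'[symmetric] by (intro infsum_cong) simp
  also have "(\<Sum>\<^sub>\<infinity>m. w m * p2 m) = (\<Sum>\<^sub>\<infinity>m\<in>{k..}. w m * p2 m)"
    by (rule infsum_cong_neutral) (auto simp: w0 not_le)
  finally have eq2: "1 / qpoch_inf (q ^ 2) (q ^ 2) * (\<Sum>\<^sub>\<infinity>m\<in>{k..}. w m * p2 m)
      = (\<Sum>\<^sub>\<infinity>i. \<Sum>\<^sub>\<infinity>j\<in>{i + k..}. w (j - i) * u2 i j)"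
    unfolding dbl2(3) by simp

  show ?thesis
    unfolding v_eq w_eq w_eq'
    using sumV dbl1(1,2) eq1 sumW dbl2(1,2) eq2
    unfolding p1_def p2_def u1_def u2_def by blast
qed

end
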